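(* Let $c>0$. For any orthonormal basis $(\phi_n)_{n\ge 0}$ of $L^2([-1,1])$ (real-valued functions), let $T_M$ be the $M\times M$ matrix $$T_M(k,j)=\int_{-1}^1\int_{-1}^1\frac{\sin(c(x-y))}{c(x-y)}\,\phi_{k-1}(x)\phi_{j-1}(y)\,dx\,dy .$$ Then $T_M$ has the following properties: 1. For all $k,j\in\{1,\dots,M\}$, $T_M(k,j)=\frac{\pi}{c}\langle\mathcal{Q}_c\phi_{k-1},\phi_{j-1}\rangle=\frac{\pi}{c}\langle\mathcal{F}_c\phi_{k-1},\mathcal{F}_c\phi_{j-1}\rangle$. 2. For all $k,j\in\{1,\dots,M\}$, $T_M(k,j)=\frac{\pi}{c}\langle DB_cD\phi_{k-1},\phi_{j-1}\rangle_{L^2(\mathbb{R})}$. 3. $T_M$ is positive, i.e. $\langle T_Mx,x\rangle\ge 0$ for all $x\in\mathbb{R}^M$. 4. For all $k,j\in\{1,\dots,M\}$, $T_M(k,j)=\frac{\pi}{c}\sum_{n=0}^{\infty}\lambda_n(c)\,\beta^n_{k-1}(c)\,\beta^n_{j-1}(c)$, where $\lambda_n(c)$ are the eigenvalues of $\mathcal{Q}_c$ and $\beta^n_k(c)=\int_{-1}^1\psi_{n,c}(x)\phi_k(x)\,dx$.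
   Context: $\mathcal{Q}_c$ is the integral operator on $L^2([-1,1])$ given by $\mathcal{Q}_c\psi(x)=\int_{-1}^1\frac{\sin(c(x-t))}{\pi(x-t)}\psi(t)\,dt$. Its eigenvalues, which are simple, real and positive, are $1>\lambda_0(c)>\lambda_1(c)>\cdots>0$, and $(\psi_{n,c})_{n\ge 0}$ are the associated eigenfunctions, the prolate spheroidal wave functions, which form a complete orthogonal system in $L^2([-1,1])$, normalized so that $\frac{\sin(c(x-y))}{\pi(x-y)}=\sum_{n=0}^\infty\lambda_n(c)\psi_{n,c}(x)\psi_{n,c}(y)$. The operator $\mathcal{F}_c:L^2([-1,1])\to L^2([-1,1])$ is $\mathcal{F}_c(g)(x)=\int_{-1}^1g(t)e^{-icxt}\,dt$. With $\mathcal{F}(g)(x)=\frac{1}{\sqrt{2\pi}}\int_{\mathbb{R}}e^{-itx}g(t)\,dt$, define on $L^2(\mathbb{R})$ the projections $B_cg=\mathcal{F}^{-1}\mathbf{1}_{[-c,c]}\mathcal{F}g$ and $Dg=g\,\mathbf{1}_{[-1,1]}$; functions on $[-1,1]$ are extended by $0$ to $\mathbb{R}$. Inner products without subscript on functions are those of $L^2([-1,1])$.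
   Formalization: In item 1 the factor π/c before ⟨F_c φ_{k-1}, F_c φ_{j-1}⟩ is replaced by 1/2, since with the given unnormalized F_c one has ⟨F_c f, F_c g⟩ = (2π/c)⟨Q_c f, g⟩, so the printed equality fails for k = j unless c = 2π. *)

theory Defs
  imports "HOL-Probability.Sinc_Integral" "Jordan_Normal_Form.Matrix"
begin

text \<open>
  Elements of \<open>L\<^sup>2(S)\<close> are represented by Lebesgue measurable, square-integrable functions
  \<open>real \<Rightarrow> complex\<close>; values outside \<open>S\<close> are irrelevant, and equality in \<open>L\<^sup>2(S)\<close> is
  equality almost everywhere.
\<close>

definition L2_on :: "real set \<Rightarrow> (real \<Rightarrow> complex) set" where
  "L2_on S = {f \<in> borel_measurable (lebesgue_on S). integrable (lebesgue_on S) (\<lambda>x. (norm (f x))\<^sup>2)}"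

definition inner_on :: "real set \<Rightarrow> (real \<Rightarrow> complex) \<Rightarrow> (real \<Rightarrow> complex) \<Rightarrow> complex" where
  "inner_on S f g = (LINT x|lebesgue_on S. f x * cnj (g x))"

definition orthogonal_on :: "real set \<Rightarrow> (nat \<Rightarrow> real \<Rightarrow> complex) \<Rightarrow> bool" where
  "orthogonal_on S e \<longleftrightarrow> (\<forall>m n. m \<noteq> n \<longrightarrow> inner_on S (e m) (e n) = 0)"

text \<open>Completeness: the finite linear combinations are dense in \<open>L\<^sup>2(S)\<close>.\<close>

definition complete_on :: "real set \<Rightarrow> (nat \<Rightarrow> real \<Rightarrow> complex) \<Rightarrow> bool" where
  "complete_on S e \<longleftrightarrow>
     (\<forall>n. e n \<in> L2_on S) \<and>
     (\<forall>f\<in>L2_on S. \<forall>\<epsilon>>0. \<exists>N a.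
        (LINT x|lebesgue_on S. (norm (f x - (\<Sum>n<N. a n * e n x)))\<^sup>2) < \<epsilon>)"

definition orthonormal_basis_on :: "real set \<Rightarrow> (nat \<Rightarrow> real \<Rightarrow> complex) \<Rightarrow> bool" where
  "orthonormal_basis_on S e \<longleftrightarrow>
     orthogonal_on S e \<and> (\<forall>n. inner_on S (e n) (e n) = 1) \<and> complete_on S e"

definition cplx :: "(real \<Rightarrow> real) \<Rightarrow> real \<Rightarrow> complex" where
  "cplx f = (\<lambda>x. complex_of_real (f x))"

text \<open>
  The kernel \<open>sin (c (x - y)) / (\<pi> (x - y))\<close>, with the value \<open>c / \<pi>\<close> on the diagonal.
\<close>

definition sinc_kernel :: "real \<Rightarrow> real \<Rightarrow> real \<Rightarrow> real" where
  "sinc_kernel c x y = (if x = y then c / pi else sin (c * (x - y)) / (pi * (x - y)))"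

definition Q_op :: "real \<Rightarrow> (real \<Rightarrow> complex) \<Rightarrow> real \<Rightarrow> complex" where
  "Q_op c f x = (LINT t|lebesgue_on {-1..1}. complex_of_real (sinc_kernel c x t) * f t)"

text \<open>
  \<open>F_op\<close> carries no normalizing factor, so that \<open>F_op\<^sup>* F_op\<close> has the kernel
  \<open>2 sin (c (x - y)) / (c (x - y))\<close> and \<open>Q_op c = c / (2 \<pi>) F_op\<^sup>* F_op\<close>.  Hence
  \<open>\<pi> / c \<langle>Q_op c f, g\<rangle> = 1 / 2 \<langle>F_op c f, F_op c g\<rangle>\<close>.
\<close>

definition F_op :: "real \<Rightarrow> (real \<Rightarrow> complex) \<Rightarrow> real \<Rightarrow> complex" where
  "F_op c g x = (LINT t|lebesgue_on {-1..1}. g t * exp (- (\<i> * of_real (c * x * t))))"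

definition Q_eigenpair :: "real \<Rightarrow> complex \<Rightarrow> (real \<Rightarrow> complex) \<Rightarrow> bool" where
  "Q_eigenpair c \<mu> f \<longleftrightarrow>
     f \<in> L2_on {-1..1} \<and>
     \<not> (AE x in lebesgue_on {-1..1}. f x = 0) \<and>
     (AE x in lebesgue_on {-1..1}. Q_op c f x = \<mu> * f x)"

text \<open>
  \<open>lam\<close> is the strictly decreasing enumeration of the eigenvalues of \<open>Q_op c\<close> and \<open>psi n\<close> the
  normalized eigenfunction for \<open>lam n\<close>.  Every eigenfunction is almost everywhere equal to a
  continuous function, and \<open>psi n\<close> is that representative, so the normalizing expansion of the
  kernel is meaningful at every point.  Simplicity of the eigenvalues is expressed by strict
  monotonicity together with completeness of \<open>psi\<close>.
\<close>

definition prolate_system :: "real \<Rightarrow> (nat \<Rightarrow> real) \<Rightarrow> (nat \<Rightarrow> real \<Rightarrow> real) \<Rightarrow> bool" where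
  "prolate_system c lam psi \<longleftrightarrow>
     {\<mu>. \<exists>f. Q_eigenpair c \<mu> f} = range (\<lambda>n. complex_of_real (lam n)) \<and>
     lam 0 < 1 \<and> (\<forall>n. lam (Suc n) < lam n) \<and> (\<forall>n. 0 < lam n) \<and>
     (\<forall>n. Q_eigenpair c (of_real (lam n)) (cplx (psi n))) \<and>
     (\<forall>n. continuous_on {-1..1} (psi n)) \<and>
     orthogonal_on {-1..1} (\<lambda>n. cplx (psi n)) \<and>
     complete_on {-1..1} (\<lambda>n. cplx (psi n)) \<and>
     (\<forall>x\<in>{-1..1}. \<forall>y\<in>{-1..1}. (\<lambda>n. lam n * psi n x * psi n y) sums sinc_kernel c x y)"

text \<open>
  The Fourier transform on \<open>L\<^sup>2(\<real>)\<close> is the \<open>L\<^sup>2\<close> limit of the transforms of the truncations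
  of \<open>g\<close> to \<open>[-N, N]\<close>; it is determined up to a null set.  For \<open>g\<close> in \<open>L\<^sup>2(\<real>)\<close> these
  transforms are in \<open>L\<^sup>2(\<real>)\<close>, and therefore so is any measurable \<open>h\<close> as in \<open>L2_lim\<close>.
  The sign \<open>s\<close> is \<open>-1\<close> for the transform and \<open>1\<close> for its inverse.
\<close>

definition L2_lim :: "(nat \<Rightarrow> real \<Rightarrow> complex) \<Rightarrow> real \<Rightarrow> complex" where
  "L2_lim G = (SOME h. h \<in> borel_measurable lebesgue \<and>
     (\<lambda>N. \<integral>\<^sup>+ x. ennreal ((norm (G N x - h x))\<^sup>2) \<partial>lebesgue) \<longlonglongrightarrow> 0)"

definition fourier_trunc :: "real \<Rightarrow> (real \<Rightarrow> complex) \<Rightarrow> nat \<Rightarrow> real \<Rightarrow> complex" where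
  "fourier_trunc s g N x =
     of_real (1 / sqrt (2 * pi)) *
     (LINT t|lebesgue_on {- real N..real N}. exp (\<i> * of_real (s * t * x)) * g t)"

definition fourier_L2 :: "(real \<Rightarrow> complex) \<Rightarrow> real \<Rightarrow> complex" where
  "fourier_L2 g = L2_lim (fourier_trunc (-1) g)"

definition fourier_inv_L2 :: "(real \<Rightarrow> complex) \<Rightarrow> real \<Rightarrow> complex" where
  "fourier_inv_L2 g = L2_lim (fourier_trunc 1 g)"

definition B_op :: "real \<Rightarrow> (real \<Rightarrow> complex) \<Rightarrow> real \<Rightarrow> complex" where
  "B_op c g = fourier_inv_L2 (\<lambda>x. indicator {-c..c} x * fourier_L2 g x)"

definition D_op :: "(real \<Rightarrow> complex) \<Rightarrow> real \<Rightarrow> complex" where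
  "D_op g = (\<lambda>x. g x * indicator {-1..1} x)"

definition zero_ext :: "(real \<Rightarrow> complex) \<Rightarrow> real \<Rightarrow> complex" where
  "zero_ext f = (\<lambda>x. if x \<in> {-1..1} then f x else 0)"

text \<open>Matrix entries are indexed from \<open>0\<close>: \<open>T\<^sub>M(k, j)\<close> is \<open>T_mat c phi M $$ (k - 1, j - 1)\<close>.\<close>

definition T_mat :: "real \<Rightarrow> (nat \<Rightarrow> real \<Rightarrow> real) \<Rightarrow> nat \<Rightarrow> real mat" where
  "T_mat c phi M = Matrix.mat M M (\<lambda>(k, j).
     LINT y|lebesgue_on {-1..1}. LINT x|lebesgue_on {-1..1}.
       sinc (c * (x - y)) * phi k x * phi j y)"

definition beta :: "(nat \<Rightarrow> real \<Rightarrow> real) \<Rightarrow> (nat \<Rightarrow> real \<Rightarrow> real) \<Rightarrow> nat \<Rightarrow> nat \<Rightarrow> real" where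
  "beta psi phi n k = (LINT x|lebesgue_on {-1..1}. psi n x * phi k x)"

end

theory Submission
  imports Defs
begin

text \<open>
  Everything rests on the elementary integral of \<open>exp (\<i> s y)\<close> over \<open>[-a, a]\<close>, which is \<open>2 a sinc (a y)\<close>:
  by Fubini, integrating \<open>exp (\<i> b s x) F_op b g s\<close> over \<open>[-a, a]\<close> yields a sinc convolution of \<open>g\<close>.
  With \<open>a = 1\<close>, \<open>b = c\<close> this relates \<open>F_op c\<close> to \<open>Q_op c\<close>; with \<open>a = c\<close>, \<open>b = 1\<close> it
  identifies \<open>B_op c\<close> with \<open>Q_op c\<close> on functions supported in \<open>[-1, 1]\<close>.  Neither step needs
  Plancherel, because the truncated transforms of a compactly supported function are eventually
  constant.  For the eigenfunction expansion, AM-GM and the values on the diagonal bound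
  all partial sums of the kernel by \<open>c / \<pi>\<close>, so dominated convergence applies.
\<close>

section \<open>Integrability, Fubini and measurability for bounded kernels\<close>

lemma integrable_mult_bounded:
  fixes f g :: "'a \<Rightarrow> 'b::{real_normed_field, banach, second_countable_topology}"
  assumes [measurable]: "f \<in> borel_measurable M"
    and B: "\<And>x. x \<in> space M \<Longrightarrow> norm (f x) \<le> B"
    and g: "integrable M g"
  shows "integrable M (\<lambda>x. f x * g x)"
proof (rule Bochner_Integration.integrable_bound)
  have [measurable]: "g \<in> borel_measurable M" using g by auto
  show "(\<lambda>x. f x * g x) \<in> borel_measurable M" by measurable
  show "integrable M (\<lambda>x. B * norm (g x))" using g by simp
  show "AE x in M. norm (f x * g x) \<le> norm (B * norm (g x))"
  proof (rule AE_I2)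
    fix x assume "x \<in> space M"
    then have "norm (f x) \<le> \<bar>B\<bar>" using B by fastforce
    then show "norm (f x * g x) \<le> norm (B * norm (g x))"
      by (simp add: norm_mult abs_mult mult_right_mono)
  qed
qed

text \<open>The dominating function \<open>B * norm (g y)\<close> does not depend on
  \<open>x\<close>, so finiteness of \<open>M\<close> makes it integrable over the product. The
  kernel \<open>k\<close> may thus carry every factor that is merely bounded, while \<open>g\<close>
  is only integrable.\<close>

lemma Fubini_bounded_kernel:
  fixes k :: "'a \<Rightarrow> 'b \<Rightarrow> complex"
  assumes "finite_measure M" "sigma_finite_measure N"
    and k [measurable]: "case_prod k \<in> borel_measurable (M \<Otimes>\<^sub>M N)"
    and B: "\<And>x y. x \<in> space M \<Longrightarrow> y \<in> space N \<Longrightarrow> norm (k x y) \<le> B"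
    and g: "integrable N g"
  shows "(LINT x|M. LINT y|N. k x y * g y) = (LINT y|N. (LINT x|M. k x y) * g y)"
proof -
  interpret M: finite_measure M by fact
  interpret N: sigma_finite_measure N by fact
  interpret P: pair_sigma_finite M N by unfold_locales
  have [measurable]: "g \<in> borel_measurable N" using g by auto
  have int: "integrable N (\<lambda>y. k x y * g y)" if [measurable]: "x \<in> space M" for x
    using B[OF that] g by (intro integrable_mult_bounded[where B = B]) measurable
  have "integrable (M \<Otimes>\<^sub>M N) (\<lambda>(x, y). k x y * g y)"
  proof (rule P.Fubini_integrable)
    show "integrable M (\<lambda>x. LINT y|N. norm (case (x, y) of (x, y) \<Rightarrow> k x y * g y))"
    proof (rule M.integrable_const_bound[where B = "LINT y|N. B * norm (g y)"])
      show "AE x in M. norm (LINT y|N. norm (case (x, y) of (x, y) \<Rightarrow> k x y * g y))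
              \<le> (LINT y|N. B * norm (g y))"
      proof (rule AE_I2)
        fix x assume x: "x \<in> space M"
        have "(LINT y|N. norm (k x y * g y)) \<le> (LINT y|N. B * norm (g y))"
          using integrable_norm[OF int[OF x]] g B[OF x]
          by (intro integral_mono) (auto simp: norm_mult intro: mult_right_mono)
        then show "norm (LINT y|N. norm (case (x, y) of (x, y) \<Rightarrow> k x y * g y))
              \<le> (LINT y|N. B * norm (g y))" by simp
      qed
    qed measurable
  qed (use int in auto)
  from P.Fubini_integral[OF this] show ?thesis by simp
qed

text \<open>The product of two Lebesgue sigma-algebras is not the Lebesgue sigma-algebra of the
  plane, so joint measurability is reached through Borel sets: each coordinate is measurable into
  \<open>borel\<close>, and the Borel sets of the plane are generated by products.\<close>

lemma measurable_lebesgue_on_pair: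
  fixes f :: "real \<times> real \<Rightarrow> 'c::topological_space"
  assumes "f \<in> borel_measurable borel"
  shows "f \<in> borel_measurable (lebesgue_on S \<Otimes>\<^sub>M lebesgue_on T)"
proof -
  have *: "(\<lambda>x. x) \<in> lebesgue_on U \<rightarrow>\<^sub>M borel" for U :: "real set"
    using measurable_completion[of "\<lambda>x. x" lborel borel]
    by (intro measurable_restrict_space1) simp
  have "(\<lambda>p. (fst p, snd p)) \<in> lebesgue_on S \<Otimes>\<^sub>M lebesgue_on T \<rightarrow>\<^sub>M borel \<Otimes>\<^sub>M borel"
    by (intro measurable_Pair measurable_compose[OF measurable_fst *] measurable_compose[OF measurable_snd *])
  then have "(\<lambda>p. p) \<in> lebesgue_on S \<Otimes>\<^sub>M lebesgue_on T \<rightarrow>\<^sub>M (borel :: (real \<times> real) measure)"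
    by (simp add: borel_prod)
  from measurable_compose[OF this assms] show ?thesis .
qed

lemma finite_measure_lebesgue_Icc: "finite_measure (lebesgue_on {a..b::real})"
  by (simp add: finite_measure_lebesgue_on)

lemma sigma_finite_lebesgue_Icc: "sigma_finite_measure (lebesgue_on {a..b::real})"
  using finite_measure_lebesgue_Icc[of a b] by (simp add: finite_measure_def)

section \<open>The finite Fourier transform and the sinc kernel\<close>

lemma integral_exp_symmetric:
  fixes a y :: real
  assumes "a > 0"
  shows "(LINT s|lebesgue_on {-a..a}. exp (\<i> * of_real (s * y))) = complex_of_real (2 * a * sinc (a * y))"
proof -
  have "(LINT s|lebesgue_on {-a..a}. exp (\<i> * of_real (s * y))) =
    integral {-a..a} (\<lambda>s. exp (\<i> * of_real (s * y)))"
    by (intro lebesgue_integral_eq_integral continuous_imp_integrable_real continuous_intros) auto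
  also have "\<dots> = of_real (2 * a * sinc (a * y))"
  \<comment> \<open>The antiderivative \<open>?F\<close> divides by \<open>y\<close>; at
    \<open>y = 0\<close> the integrand is 1 and \<open>sinc 0 = 1\<close>.\<close>
  proof (cases "y = 0")
    case False
    let ?F = "\<lambda>s. exp (\<i> * of_real (s * y)) / (\<i> * of_real y)"
    have "((\<lambda>s. exp (\<i> * of_real (s * y))) has_integral (?F a - ?F (-a))) {-a..a}"
      using assms False
    proof (intro fundamental_theorem_of_calculus)
      fix s
      \<comment> \<open>Differentiate in a complex variable first, then restrict to the real
        line.\<close>
      have "((\<lambda>z. exp (\<i> * (z * of_real y)) / (\<i> * of_real y)) has_field_derivative
          exp (\<i> * (of_real s * of_real y))) (at (of_real s))"
        using False by (auto intro!: derivative_eq_intros simp: mult_ac)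
      from has_vector_derivative_real_field[OF this]
      show "(?F has_vector_derivative exp (\<i> * of_real (s * y))) (at s within {-a..a})"
        by simp
    qed (use assms in simp)
    moreover have "?F a - ?F (-a) = of_real (2 * a * sinc (a * y))"
      using assms False
      by (simp add: exp_Euler exp_minus_Euler field_simps flip: cos_of_real sin_of_real)
    ultimately show ?thesis by (simp add: integral_unique)
  qed (use assms in \<open>simp add: scaleR_conv_of_real\<close>)
  finally show ?thesis .
qed

abbreviation (input) leb_I :: "real measure"
  where "leb_I \<equiv> lebesgue_on {-1..1}"

text \<open>The set \<open>S\<close> is free because the transform is integrated over
  \<open>{-1..1}\<close> and \<open>{-c..c}\<close> and is also used on the whole line.\<close>

lemma borel_measurable_F_op:
  assumes "integrable leb_I g"
  shows "F_op b g \<in> borel_measurable (lebesgue_on S)"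
proof -
  interpret sigma_finite_measure leb_I by (rule sigma_finite_lebesgue_Icc)
  have [measurable]: "g \<in> borel_measurable leb_I" using assms by auto
  have "(\<lambda>p. exp (- (\<i> * of_real (b * fst p * snd p)))) \<in> borel_measurable (lebesgue_on S \<Otimes>\<^sub>M leb_I)"
    by (intro measurable_lebesgue_on_pair borel_measurable_continuous_onI continuous_intros)
  then have "(\<lambda>x. LINT t|leb_I. g t * exp (- (\<i> * of_real (b * x * t)))) \<in> borel_measurable (lebesgue_on S)"
    by (intro borel_measurable_lebesgue_integral) (simp add: split_beta')
  then show ?thesis by (simp add: F_op_def[abs_def])
qed

text \<open>The exponential has modulus 1. The bound is uniform in \<open>s\<close>, which lets a
  transform act as a bounded factor in Fubini and in products.\<close>

lemma norm_F_op_le: "norm (F_op b g s) \<le> (LINT u|leb_I. norm (g u))"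
proof -
  have "norm (F_op b g s) \<le> (LINT u|leb_I. norm (g u * exp (- (\<i> * of_real (b * s * u)))))"
    unfolding F_op_def by (rule integral_norm_bound)
  then show ?thesis by (simp add: norm_mult)
qed

text \<open>The two phases merge into a single one of frequency \<open>b * (x - u)\<close>; after
  swapping the integrals, \<open>integral_exp_symmetric\<close> evaluates the integral over
  \<open>s\<close>.\<close>

lemma integral_exp_F_op:
  assumes "a > 0" and g: "integrable leb_I g"
  shows "(LINT s|lebesgue_on {-a..a}. exp (\<i> * of_real (b * s * x)) * F_op b g s)
    = of_real (2 * a) * (LINT u|leb_I. of_real (sinc (a * b * (x - u))) * g u)"
proof -
  have "exp (\<i> * of_real (b * s * x)) * F_op b g s
      = (LINT u|leb_I. exp (\<i> * of_real (s * (b * (x - u)))) * g u)" for s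
  proof -
    have "exp (\<i> * of_real (b * s * x)) * F_op b g s
        = (LINT u|leb_I. exp (\<i> * of_real (b * s * x)) * (g u * exp (- (\<i> * of_real (b * s * u)))))"
      by (simp add: F_op_def)
    also have "\<dots> = (LINT u|leb_I. exp (\<i> * of_real (s * (b * (x - u)))) * g u)"
      by (intro Bochner_Integration.integral_cong refl)
        (simp add: exp_minus exp_diff field_simps)
    finally show ?thesis .
  qed
  then have "(LINT s|lebesgue_on {-a..a}. exp (\<i> * of_real (b * s * x)) * F_op b g s)
     = (LINT s|lebesgue_on {-a..a}. LINT u|leb_I. exp (\<i> * of_real (s * (b * (x - u)))) * g u)"
    by simp
  also have "\<dots> = (LINT u|leb_I. (LINT s|lebesgue_on {-a..a}. exp (\<i> * of_real (s * (b * (x - u))))) * g u)"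
  proof (rule Fubini_bounded_kernel[where B = 1])
    show "(\<lambda>(s, u). exp (\<i> * of_real (s * (b * (x - u))))) \<in> borel_measurable (lebesgue_on {-a..a} \<Otimes>\<^sub>M leb_I)"
      by (intro measurable_lebesgue_on_pair borel_measurable_continuous_onI)
        (auto simp: split_beta' intro!: continuous_intros)
  qed (use g finite_measure_lebesgue_Icc sigma_finite_lebesgue_Icc in auto)
  also have "\<dots> = (LINT u|leb_I. of_real (2 * a) * (of_real (sinc (a * b * (x - u))) * g u))"
    unfolding integral_exp_symmetric[OF \<open>a > 0\<close>] by (simp only: of_real_mult mult.assoc)
  finally show ?thesis by simp
qed

lemma sinc_kernel_eq: "c > 0 \<Longrightarrow> sinc_kernel c x y = c / pi * sinc (c * (x - y))"
  by (simp add: sinc_kernel_def)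

lemma Q_op_eq_sinc:
  assumes "c > 0"
  shows "Q_op c g x = of_real (c / pi) * (LINT u|leb_I. of_real (sinc (c * (x - u))) * g u)"
  unfolding Q_op_def sinc_kernel_eq[OF assms] by (simp add: mult.assoc)

text \<open>Unfolding the second transform and swapping integrals puts the adjoint of
  \<open>F_op c\<close> on \<open>F_op c f\<close>. By \<open>integral_exp_F_op\<close> this is 2
  times a sinc convolution, and since \<open>Q_op\<close> carries the factor \<open>c / pi\<close>,
  the constant is \<open>2 * pi / c\<close>.\<close>

lemma inner_F_op:
  assumes "c > 0" and f: "integrable leb_I f" and g: "integrable leb_I g"
  shows "inner_on {-1..1} (F_op c f) (F_op c g) = of_real (2 * pi / c) * inner_on {-1..1} (Q_op c f) g"
proof -
  have [measurable]: "F_op c f \<in> borel_measurable leb_I"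
    by (rule borel_measurable_F_op) fact
  have "inner_on {-1..1} (F_op c f) (F_op c g)
     = (LINT s|leb_I. LINT u|leb_I. exp (\<i> * of_real (c * s * u)) * F_op c f s * cnj (g u))"
  proof -
    have "F_op c f s * cnj (F_op c g s) = (LINT u|leb_I. exp (\<i> * of_real (c * s * u)) * F_op c f s * cnj (g u))" for s
    proof -
      have "F_op c f s * cnj (F_op c g s) = F_op c f s * (LINT u|leb_I. cnj (g u * exp (- (\<i> * of_real (c * s * u)))))"
        by (simp only: F_op_def Bochner_Integration.integral_cnj)
      also have "\<dots> = (LINT u|leb_I. F_op c f s * (cnj (g u * exp (- (\<i> * of_real (c * s * u))))))"
        by simp
      also have "\<dots> = (LINT u|leb_I. exp (\<i> * of_real (c * s * u)) * F_op c f s * cnj (g u))"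
        by (simp add: exp_cnj mult_ac)
      finally show ?thesis .
    qed
    then show ?thesis by (simp add: inner_on_def)
  qed
  also have "\<dots> = (LINT u|leb_I. (LINT s|leb_I. exp (\<i> * of_real (c * s * u)) * F_op c f s) * cnj (g u))"
  \<comment> \<open>Here the transform of \<open>f\<close> belongs to the kernel, so the bound is
    the L^1 norm of \<open>f\<close>.\<close>
  proof (rule Fubini_bounded_kernel[where B = "LINT u|leb_I. norm (f u)"])
    have [measurable]: "(\<lambda>p. exp (\<i> * of_real (c * fst p * snd p))) \<in> borel_measurable (leb_I \<Otimes>\<^sub>M leb_I)"
      by (intro measurable_lebesgue_on_pair borel_measurable_continuous_onI continuous_intros)
    have "(\<lambda>p. exp (\<i> * of_real (c * fst p * snd p)) * F_op c f (fst p)) \<in> borel_measurable (leb_I \<Otimes>\<^sub>M leb_I)"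
      by (intro borel_measurable_times measurable_compose[OF measurable_fst]) fact+
    then show "(\<lambda>(s, u). exp (\<i> * of_real (c * s * u)) * F_op c f s) \<in> borel_measurable (leb_I \<Otimes>\<^sub>M leb_I)"
      by (simp add: split_beta')
  qed (use g norm_F_op_le finite_measure_lebesgue_Icc sigma_finite_lebesgue_Icc in \<open>auto simp: norm_mult\<close>)
  also have "\<dots> = (LINT u|leb_I. of_real (2 * pi / c) * (Q_op c f u * cnj (g u)))"
    using integral_exp_F_op[of 1 f c, unfolded mult_1_left mult_1_right] f \<open>c > 0\<close>
    by (simp add: Q_op_eq_sinc mult.assoc)
  finally show ?thesis by (simp add: inner_on_def)
qed

section \<open>Fourier transforms of compactly supported functions and band limiting\<close>

text \<open>The eventual value \<open>h\<close> witnesses the choice in \<open>L2_lim\<close>, so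
  the chosen function is a limit too. Its squared distances from \<open>G N\<close> are eventually
  the constant squared distance from \<open>h\<close>, and they tend to 0, so this constant is
  0.\<close>

lemma L2_lim_eventually_const:
  assumes h: "h \<in> borel_measurable lebesgue" and ev: "eventually (\<lambda>N. G N = h) sequentially"
  shows "L2_lim G \<in> borel_measurable lebesgue" "AE x in lebesgue. L2_lim G x = h x"
proof -
  let ?P = "\<lambda>k. k \<in> borel_measurable lebesgue \<and>
     (\<lambda>N. \<integral>\<^sup>+ x. ennreal ((norm (G N x - k x))\<^sup>2) \<partial>lebesgue) \<longlonglongrightarrow> 0"
  have "?P h"
    using h by (auto intro!: tendsto_eventually eventually_mono[OF ev])
  then have P: "?P (L2_lim G)"
    unfolding L2_lim_def by (rule someI[of ?P])
  then show [measurable]: "L2_lim G \<in> borel_measurable lebesgue" by blast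
  note h[measurable]
  have "(\<lambda>N. \<integral>\<^sup>+ x. ennreal ((norm (G N x - L2_lim G x))\<^sup>2) \<partial>lebesgue)
      \<longlonglongrightarrow> (\<integral>\<^sup>+ x. ennreal ((norm (h x - L2_lim G x))\<^sup>2) \<partial>lebesgue)"
    by (auto intro!: tendsto_eventually eventually_mono[OF ev])
  with P have "(\<integral>\<^sup>+ x. ennreal ((norm (h x - L2_lim G x))\<^sup>2) \<partial>lebesgue) = 0"
    using LIMSEQ_unique by blast
  then show "AE x in lebesgue. L2_lim G x = h x"
    by (subst (asm) nn_integral_0_iff_AE) auto
qed

lemma integral_lebesgue_on_subset:
  fixes h :: "real \<Rightarrow> complex"
  assumes "A \<subseteq> B" "A \<in> sets lebesgue" "B \<in> sets lebesgue" "\<And>x. x \<notin> A \<Longrightarrow> h x = 0"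
  shows "integral\<^sup>L (lebesgue_on B) h = integral\<^sup>L (lebesgue_on A) h"
  using assms
  by (auto simp: integral_restrict_space indicator_def intro!: Bochner_Integration.integral_cong)

text \<open>Once \<open>N\<close> exceeds \<open>a\<close>, the window contains the support of
  \<open>g\<close>. The equality is one of functions, at every point, as
  \<open>L2_lim_eventually_const\<close> demands.\<close>

lemma fourier_trunc_eventually:
  assumes "a > 0" and g: "\<And>t. t \<notin> {-a..a} \<Longrightarrow> g t = 0"
  shows "eventually (\<lambda>N. fourier_trunc s g N =
    (\<lambda>x. of_real (1 / sqrt (2 * pi)) * (LINT t|lebesgue_on {-a..a}. exp (\<i> * of_real (s * t * x)) * g t))) sequentially"
proof -
  obtain N0 :: nat where N0: "a \<le> real N0" using real_arch_simple by blast
  show ?thesis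
  proof (rule eventually_sequentiallyI[of N0])
    fix N assume "N0 \<le> N"
    then have "{-a..a} \<subseteq> {- real N..real N}" using N0 by auto
    then show "fourier_trunc s g N = (\<lambda>x. of_real (1 / sqrt (2 * pi)) *
        (LINT t|lebesgue_on {-a..a}. exp (\<i> * of_real (s * t * x)) * g t))"
      unfolding fourier_trunc_def
      by (intro ext arg_cong2[where f = times] refl integral_lebesgue_on_subset) (auto simp: g)
  qed
qed

lemma fourier_L2_zero_ext:
  assumes f: "integrable leb_I f"
  shows "fourier_L2 (zero_ext f) \<in> borel_measurable lebesgue"
    "AE x in lebesgue. fourier_L2 (zero_ext f) x = of_real (1 / sqrt (2 * pi)) * F_op 1 f x"
proof -
  let ?h = "\<lambda>x. of_real (1 / sqrt (2 * pi)) * F_op 1 f x"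
  have *: "(LINT t|leb_I. exp (\<i> * of_real (-1 * t * x)) * zero_ext f t) = F_op 1 f x" for x
    unfolding F_op_def by (rule Bochner_Integration.integral_cong) (auto simp: zero_ext_def mult_ac)
  have zero: "zero_ext f t = 0" if "t \<notin> {-1..1}" for t
    using that by (auto simp: zero_ext_def)
  have ev: "eventually (\<lambda>N. fourier_trunc (-1) (zero_ext f) N = ?h) sequentially"
    using fourier_trunc_eventually[of 1 "zero_ext f" "-1", OF _ zero, unfolded *] by simp
  have "?h \<in> borel_measurable lebesgue"
    using borel_measurable_F_op[OF f, of 1 UNIV] unfolding lebesgue_on_UNIV_eq by measurable
  from L2_lim_eventually_const[OF this ev]
  show "fourier_L2 (zero_ext f) \<in> borel_measurable lebesgue"
    "AE x in lebesgue. fourier_L2 (zero_ext f) x = ?h x"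
    unfolding fourier_L2_def by auto
qed

lemma borel_measurable_Q_op:
  assumes "integrable leb_I g" "c > 0"
  shows "Q_op c g \<in> borel_measurable (lebesgue_on S)"
proof -
  interpret sigma_finite_measure leb_I by (rule sigma_finite_lebesgue_Icc)
  have [measurable]: "g \<in> borel_measurable leb_I" using assms by auto
  have "(\<lambda>p. complex_of_real (sinc (c * (fst p - snd p)))) \<in> borel_measurable (lebesgue_on S \<Otimes>\<^sub>M leb_I)"
    by (intro measurable_lebesgue_on_pair borel_measurable_continuous_onI continuous_intros)
  then have [measurable]: "(\<lambda>x. LINT t|leb_I. complex_of_real (sinc (c * (x - t))) * g t) \<in> borel_measurable (lebesgue_on S)"
    by (intro borel_measurable_lebesgue_integral) (simp add: split_beta')
  show ?thesis unfolding Q_op_eq_sinc[OF \<open>c > 0\<close>, abs_def] by measurable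
qed

text \<open>The band-limited transform is supported in \<open>{-c..c}\<close>, so the truncated
  inverse transforms are eventually constant as well. The forward transform is known only up to a
  null set, but integrating over it gives \<open>Q_op c f\<close> at every point.\<close>

lemma B_op_zero_ext:
  assumes f: "integrable leb_I f" and "c > 0"
  shows "B_op c (zero_ext f) \<in> borel_measurable lebesgue"
    "AE x in lebesgue. B_op c (zero_ext f) x = Q_op c f x"
proof -
  let ?F = "fourier_L2 (zero_ext f)"
  let ?g = "\<lambda>t. indicator {-c..c} t * ?F t"
  note [measurable] = fourier_L2_zero_ext(1)[OF f] borel_measurable_F_op[OF f]
  have [measurable]: "?F \<in> borel_measurable (lebesgue_on {-c..c})"
    by (rule measurable_restrict_space1) measurable
  have *: "of_real (1 / sqrt (2 * pi)) * (LINT t|lebesgue_on {-c..c}. exp (\<i> * of_real (1 * t * x)) * ?g t) = Q_op c f x" for x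
  proof -
    have "(\<lambda>t. exp (\<i> * of_real (1 * t * x))) \<in> borel_measurable (lebesgue_on {-c..c})"
      by (intro continuous_imp_measurable_on_sets_lebesgue continuous_intros) auto
    note [measurable] = this
    have "(LINT t|lebesgue_on {-c..c}. exp (\<i> * of_real (1 * t * x)) * ?g t)
        = (LINT t|lebesgue_on {-c..c}. exp (\<i> * of_real (1 * t * x)) * ?F t)"
      by (rule Bochner_Integration.integral_cong) auto
    also have "\<dots> = (LINT t|lebesgue_on {-c..c}. of_real (1 / sqrt (2 * pi)) * (exp (\<i> * of_real (1 * t * x)) * F_op 1 f t))"
    proof (rule integral_cong_AE)
      have "AE t in lebesgue_on {-c..c}. ?F t = of_real (1 / sqrt (2 * pi)) * F_op 1 f t"
        using fourier_L2_zero_ext(2)[OF f] by (auto simp: AE_restrict_space_iff)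
      then show "AE t in lebesgue_on {-c..c}. exp (\<i> * of_real (1 * t * x)) * ?F t
          = of_real (1 / sqrt (2 * pi)) * (exp (\<i> * of_real (1 * t * x)) * F_op 1 f t)"
        by eventually_elim simp
    qed measurable
    also have "\<dots> = of_real (1 / sqrt (2 * pi)) * (of_real (2 * c) * (LINT u|leb_I. of_real (sinc (c * (x - u))) * f u))"
      using integral_exp_F_op[OF \<open>c > 0\<close> f, of 1 x, unfolded mult_1_right] by simp
    \<comment> \<open>The two normalizing factors \<open>1 / sqrt (2 * pi)\<close> and
      \<open>2 * c\<close> multiply to \<open>c / pi\<close>, the constant in
      \<open>Q_op_eq_sinc\<close>.\<close>
    finally show ?thesis
      using \<open>c > 0\<close> by (simp add: Q_op_eq_sinc flip: of_real_mult mult.assoc) simp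
  qed
  have ev: "eventually (\<lambda>N. fourier_trunc 1 ?g N = Q_op c f) sequentially"
    using fourier_trunc_eventually[OF \<open>c > 0\<close>, of ?g 1] unfolding * by auto
  have "Q_op c f \<in> borel_measurable lebesgue"
    using borel_measurable_Q_op[OF f \<open>c > 0\<close>, of UNIV] by (simp add: lebesgue_on_UNIV_eq)
  from L2_lim_eventually_const[OF this ev]
  show "B_op c (zero_ext f) \<in> borel_measurable lebesgue"
    "AE x in lebesgue. B_op c (zero_ext f) x = Q_op c f x"
    unfolding B_op_def fourier_inv_L2_def by auto
qed

text \<open>The inner \<open>D_op\<close> fixes a zero extension, and the outer one only confines
  the integral to \<open>{-1..1}\<close>, where \<open>B_op\<close> agrees almost everywhere with
  \<open>Q_op\<close>.\<close>

lemma inner_D_op_B_op_D_op: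
  assumes f: "integrable leb_I f" and g: "integrable leb_I g" and "c > 0"
  shows "inner_on UNIV (D_op (B_op c (D_op (zero_ext f)))) (zero_ext g) = inner_on {-1..1} (Q_op c f) g"
proof -
  have D: "D_op (zero_ext f) = zero_ext f" by (auto simp: D_op_def zero_ext_def)
  note [measurable] = borel_measurable_Q_op[OF f \<open>c > 0\<close>]
  have [measurable]: "B_op c (zero_ext f) \<in> borel_measurable leb_I"
    by (rule measurable_restrict_space1) (rule B_op_zero_ext(1)[OF f \<open>c > 0\<close>])
  have "integrable leb_I (\<lambda>x. cnj (g x))" using g by simp
  then have [measurable]: "(\<lambda>x. cnj (g x)) \<in> borel_measurable leb_I"
    by (rule borel_measurable_integrable)
  have "inner_on UNIV (D_op (B_op c (D_op (zero_ext f)))) (zero_ext g)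
     = (LINT x|leb_I. B_op c (zero_ext f) x * cnj (g x))"
    unfolding inner_on_def D
    by (subst integral_lebesgue_on_subset[where A = "{-1..1}"])
      (auto simp: D_op_def zero_ext_def intro!: Bochner_Integration.integral_cong)
  also have "\<dots> = (LINT x|leb_I. Q_op c f x * cnj (g x))"
  proof (rule integral_cong_AE)
    have "AE x in leb_I. B_op c (zero_ext f) x = Q_op c f x"
      using B_op_zero_ext(2)[OF f \<open>c > 0\<close>] by (auto simp: AE_restrict_space_iff)
    then show "AE x in leb_I. B_op c (zero_ext f) x * cnj (g x) = Q_op c f x * cnj (g x)"
      by eventually_elim simp
  qed measurable
  finally show ?thesis by (simp add: inner_on_def)
qed

section \<open>The matrix entries as a real bilinear form, and positivity\<close>

text \<open>The argument \<open>y - x\<close> makes the inner integral \<open>Q_op c f y\<close> up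
  to the factor \<open>c / pi\<close>; evenness of \<open>sinc\<close> reconciles it with the
  \<open>x - y\<close> of \<open>T_mat\<close>.\<close>

definition sinc_form :: "real \<Rightarrow> (real \<Rightarrow> real) \<Rightarrow> (real \<Rightarrow> real) \<Rightarrow> real" where
  "sinc_form c f g = (LINT y|leb_I. (LINT x|leb_I. sinc (c * (y - x)) * f x) * g y)"

lemma T_mat_eq_sinc_form:
  assumes "i < M" "j < M"
  shows "T_mat c phi M $$ (i, j) = sinc_form c (phi i) (phi j)"
proof -
  have "sinc (c * (x - y)) = sinc (c * (y - x))" for x y
    using sinc_neg[of "c * (y - x)"] by (simp only: minus_mult_right minus_diff_eq)
  then show ?thesis
    using assms by (simp add: T_mat_def sinc_form_def)
qed

lemma inner_Q_op:
  assumes "c > 0"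
  shows "inner_on {-1..1} (Q_op c (cplx f)) (cplx g) = of_real (c / pi * sinc_form c f g)"
proof -
  have "Q_op c (cplx f) x = of_real (c / pi * (LINT u|leb_I. sinc (c * (x - u)) * f u))" for x
    unfolding Q_op_eq_sinc[OF assms] cplx_def of_real_mult[symmetric] integral_complex_of_real ..
  then show ?thesis
    unfolding inner_on_def sinc_form_def cplx_def
    by (simp only: complex_cnj_complex_of_real of_real_mult[symmetric] integral_complex_of_real mult.assoc) simp
qed

text \<open>Completeness includes membership in L^2, and L^2 lies in L^1 on a finite measure
  space.\<close>

lemma integrable_of_complete_on:
  assumes "complete_on {-1..1} (\<lambda>n. cplx (phi n))"
  shows "integrable leb_I (phi n)"
proof -
  interpret finite_measure leb_I by (rule finite_measure_lebesgue_Icc)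
  have L2: "cplx (phi n) \<in> L2_on {-1..1}" using assms by (auto simp: complete_on_def)
  then have [measurable]: "cplx (phi n) \<in> borel_measurable leb_I" by (simp add: L2_on_def)
  have "(\<lambda>x. Re (cplx (phi n) x)) \<in> borel_measurable leb_I" by measurable
  then have "phi n \<in> borel_measurable leb_I" by (simp add: cplx_def)
  moreover have "integrable leb_I (\<lambda>x. phi n x ^ 2)" using L2 by (simp add: L2_on_def cplx_def)
  ultimately show ?thesis by (rule square_integrable_imp_integrable)
qed

lemma integrable_cplx: "integrable M f \<Longrightarrow> integrable M (cplx f)"
  by (simp add: cplx_def)

lemma sinc_form_F_op:
  assumes "c > 0" "integrable leb_I f" "integrable leb_I g"
  shows "of_real (sinc_form c f g) = 1 / 2 * inner_on {-1..1} (F_op c (cplx f)) (F_op c (cplx g))"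
  using assms by (simp add: inner_F_op inner_Q_op integrable_cplx)

text \<open>By \<open>sinc_form_F_op\<close> the coefficients form half a Gram matrix: the quadratic
  form is half the squared L^2 norm of the combination of the transforms with weights
  \<open>v\<close>.\<close>

lemma sinc_form_nonneg:
  assumes c: "c > 0" and f: "\<And>i. i \<in> S \<Longrightarrow> integrable leb_I (f i)"
  shows "0 \<le> (\<Sum>i\<in>S. \<Sum>j\<in>S. sinc_form c (f i) (f j) * v i * v j)"
proof -
  interpret finite_measure leb_I by (rule finite_measure_lebesgue_Icc)
  let ?F = "\<lambda>i. F_op c (cplx (f i))"
  have int: "integrable leb_I (\<lambda>s. ?F i s * cnj (?F j s))" if "i \<in> S" "j \<in> S" for i j
  proof (rule integrable_mult_bounded)
    have m: "?F i \<in> borel_measurable leb_I" if "i \<in> S" for i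
      by (intro borel_measurable_F_op integrable_cplx f that)
    show "?F i \<in> borel_measurable leb_I" using m that by blast
    show "norm (?F i s) \<le> (LINT u|leb_I. norm (cplx (f i) u))" for s by (rule norm_F_op_le)
    have "integrable leb_I (?F j)"
      using m that norm_F_op_le by (intro integrable_const_bound AE_I2) auto
    then show "integrable leb_I (\<lambda>s. cnj (?F j s))" by simp
  qed
  have "complex_of_real (\<Sum>i\<in>S. \<Sum>j\<in>S. sinc_form c (f i) (f j) * v i * v j)
     = (\<Sum>i\<in>S. \<Sum>j\<in>S. 1 / 2 * (of_real (v i) * (of_real (v j) * (LINT s|leb_I. ?F i s * cnj (?F j s)))))"
    unfolding of_real_sum of_real_mult
    by (intro sum.cong refl) (simp add: sinc_form_F_op c f inner_on_def)
  also have "\<dots> = 1 / 2 * (LINT s|leb_I. (\<Sum>i\<in>S. \<Sum>j\<in>S. of_real (v i) * (of_real (v j) * (?F i s * cnj (?F j s)))))"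
    using int by (simp add: sum_distrib_left)
  \<comment> \<open>The weights are real, so conjugation passes over them and the double sum is a
    number times its conjugate.\<close>
  also have "(\<lambda>s. \<Sum>i\<in>S. \<Sum>j\<in>S. of_real (v i) * (of_real (v j) * (?F i s * cnj (?F j s))))
     = (\<lambda>s. complex_of_real ((norm (\<Sum>i\<in>S. of_real (v i) * ?F i s))\<^sup>2))"
    by (simp only: complex_norm_square) (simp add: sum_product mult_ac)
  finally have "complex_of_real (\<Sum>i\<in>S. \<Sum>j\<in>S. sinc_form c (f i) (f j) * v i * v j)
     = of_real (1 / 2 * (LINT s|leb_I. (norm (\<Sum>i\<in>S. of_real (v i) * ?F i s))\<^sup>2))"
    by (simp only: integral_complex_of_real of_real_mult) simp
  then have "(\<Sum>i\<in>S. \<Sum>j\<in>S. sinc_form c (f i) (f j) * v i * v j)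
     = 1 / 2 * (LINT s|leb_I. (norm (\<Sum>i\<in>S. of_real (v i) * ?F i s))\<^sup>2)"
    by (simp only: of_real_eq_iff)
  also have "\<dots> \<ge> 0" by simp
  finally show ?thesis .
qed

section \<open>Eigenfunction expansion of the kernel under the integral\<close>

text \<open>Dominated convergence is applied twice: to the inner integral with majorant
  \<open>B * \<bar>f x\<bar>\<close>, then to the outer one with the integral of that majorant times
  \<open>\<bar>g y\<bar>\<close>.\<close>

lemma tendsto_bilinear_integral:
  fixes k :: "nat \<Rightarrow> 'a \<Rightarrow> 'a \<Rightarrow> real"
  assumes "sigma_finite_measure M"
    and k: "\<And>N. case_prod (k N) \<in> borel_measurable (M \<Otimes>\<^sub>M M)"
    and lim: "\<And>x y. x \<in> space M \<Longrightarrow> y \<in> space M \<Longrightarrow> (\<lambda>N. k N x y) \<longlonglongrightarrow> K x y"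
    and B: "\<And>N x y. x \<in> space M \<Longrightarrow> y \<in> space M \<Longrightarrow> \<bar>k N x y\<bar> \<le> B"
    and f: "integrable M f" and g: "integrable M g"
  shows "(\<lambda>N. LINT y|M. (LINT x|M. k N y x * f x) * g y) \<longlonglongrightarrow> (LINT y|M. (LINT x|M. K y x * f x) * g y)"
proof -
  interpret sigma_finite_measure M by fact
  note k[measurable]
  \<comment> \<open>Joint measurability of the limit kernel comes from pointwise convergence on the
    product space.\<close>
  have "case_prod K \<in> borel_measurable (M \<Otimes>\<^sub>M M)"
    by (rule borel_measurable_LIMSEQ_metric[OF k]) (auto simp: space_pair_measure intro: lim)
  note [measurable] = this borel_measurable_integrable[OF f] borel_measurable_integrable[OF g]
  have bound: "\<bar>k N y x * f x\<bar> \<le> B * \<bar>f x\<bar>" if "x \<in> space M" "y \<in> space M" for N x y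
    using B[OF that(2,1)] by (simp add: abs_mult mult_right_mono)
  have inner: "(\<lambda>N. LINT x|M. k N y x * f x) \<longlonglongrightarrow> (LINT x|M. K y x * f x)" if [measurable]: "y \<in> space M" for y
    using f that by (intro integral_dominated_convergence[where w = "\<lambda>x. B * \<bar>f x\<bar>"])
      (auto intro!: AE_I2 tendsto_intros lim bound)
  have inner_bound: "\<bar>LINT x|M. k N y x * f x\<bar> \<le> (LINT x|M. B * \<bar>f x\<bar>)" if [measurable]: "y \<in> space M" for N y
  proof -
    have "integrable M (\<lambda>x. k N y x * f x)"
      using B[OF that] f by (intro integrable_mult_bounded[where B = B]) auto
    then show ?thesis
      using f that bound by (intro order.trans[OF integral_abs_bound] integral_mono) auto
  qed
  show ?thesis
  proof (rule integral_dominated_convergence[where w = "\<lambda>y. (LINT x|M. B * \<bar>f x\<bar>) * \<bar>g y\<bar>"])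
    show "AE y in M. (\<lambda>N. (LINT x|M. k N y x * f x) * g y) \<longlonglongrightarrow> (LINT x|M. K y x * f x) * g y"
      by (auto intro!: AE_I2 tendsto_intros inner)
    show "AE y in M. norm ((LINT x|M. k N y x * f x) * g y) \<le> (LINT x|M. B * \<bar>f x\<bar>) * \<bar>g y\<bar>" for N
      using inner_bound by (intro AE_I2) (auto simp: abs_mult simp del: integral_mult_right_zero integral_mult_right intro!: mult_right_mono)
    show "integrable M (\<lambda>y. (LINT x|M. B * \<bar>f x\<bar>) * \<bar>g y\<bar>)" using g by simp
  qed measurable
qed

lemma prolate_partial_sum_bound:
  assumes P: "prolate_system c lam psi" and x: "x \<in> {-1..1}" and y: "y \<in> {-1..1}"
  shows "\<bar>\<Sum>n<N. lam n * psi n x * psi n y\<bar> \<le> c / pi"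
proof -
  have pos: "0 < lam n" for n using P by (simp add: prolate_system_def)
  \<comment> \<open>On the diagonal all terms are nonnegative, so partial sums stay below the full
    sum, the kernel value \<open>c / pi\<close>.\<close>
  have diag: "(\<Sum>n<N. lam n * (psi n z)\<^sup>2) \<le> c / pi" if "z \<in> {-1..1}" for z
  proof -
    have "(\<lambda>n. lam n * psi n z * psi n z) sums sinc_kernel c z z"
      using P that unfolding prolate_system_def by blast
    then have "(\<lambda>n. lam n * (psi n z)\<^sup>2) sums (c / pi)"
      by (simp add: sinc_kernel_def power2_eq_square mult.assoc)
    then show ?thesis
      using pos by (intro sum_le_suminf[THEN order.trans]) (auto simp: sums_iff less_imp_le)
  qed
  have "\<bar>lam n * psi n x * psi n y\<bar> \<le> (lam n * (psi n x)\<^sup>2 + lam n * (psi n y)\<^sup>2) / 2" for n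
  proof -
    have "0 \<le> (\<bar>psi n x\<bar> - \<bar>psi n y\<bar>)\<^sup>2" by simp
    then have "\<bar>psi n x\<bar> * \<bar>psi n y\<bar> \<le> ((psi n x)\<^sup>2 + (psi n y)\<^sup>2) / 2"
      by (simp add: power2_diff)
    then have "lam n * (\<bar>psi n x\<bar> * \<bar>psi n y\<bar>) \<le> lam n * (((psi n x)\<^sup>2 + (psi n y)\<^sup>2) / 2)"
      using pos[of n] by (intro mult_left_mono) auto
    then show ?thesis using pos[of n] by (simp add: abs_mult algebra_simps)
  qed
  then have "\<bar>\<Sum>n<N. lam n * psi n x * psi n y\<bar> \<le> (\<Sum>n<N. (lam n * (psi n x)\<^sup>2 + lam n * (psi n y)\<^sup>2) / 2)"
    by (intro order.trans[OF sum_abs] sum_mono)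
  also have "\<dots> = ((\<Sum>n<N. lam n * (psi n x)\<^sup>2) + (\<Sum>n<N. lam n * (psi n y)\<^sup>2)) / 2"
    by (simp add: sum.distrib sum_divide_distrib[symmetric])
  also have "\<dots> \<le> c / pi" using add_mono[OF diag[OF x] diag[OF y]] by (intro divide_le_eq_numeral1(1)[THEN iffD2]) (simp only: mult_2_right)
  finally show ?thesis .
qed

lemma sums_sinc_form:
  assumes "c > 0" and P: "prolate_system c lam psi"
    and f: "integrable leb_I (phi i)" and g: "integrable leb_I (phi j)"
  shows "(\<lambda>n. lam n * beta psi phi n i * beta psi phi n j) sums (c / pi * sinc_form c (phi i) (phi j))"
proof -
  let ?S = "\<lambda>N y x. \<Sum>n<N. lam n * psi n y * psi n x"
  have cont: "continuous_on {-1..1} (psi n)" for n using P by (simp add: prolate_system_def)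
  have meas[measurable]: "psi n \<in> borel_measurable leb_I" for n
    by (intro continuous_imp_measurable_on_sets_lebesgue cont) auto
  have int: "integrable leb_I (\<lambda>x. psi n x * h x)" if "integrable leb_I h" for n h
  proof -
    \<comment> \<open>Continuity on a compact interval bounds \<open>psi n\<close>, so its product
      with a merely integrable function is integrable.\<close>
    have "bounded (psi n ` {-1..1})"
      by (intro compact_imp_bounded compact_continuous_image cont) auto
    then obtain B where "\<forall>x\<in>{-1..1}. norm (psi n x) \<le> B"
      by (auto simp: bounded_iff)
    then show ?thesis using that by (intro integrable_mult_bounded[where B = B] meas) auto
  qed
  have "(\<lambda>N. LINT y|leb_I. (LINT x|leb_I. ?S N y x * phi i x) * phi j y)
      \<longlonglongrightarrow> (LINT y|leb_I. (LINT x|leb_I. sinc_kernel c y x * phi i x) * phi j y)"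
  proof (rule tendsto_bilinear_integral[where B = "c / pi"])
    show "(\<lambda>N. ?S N x y) \<longlonglongrightarrow> sinc_kernel c x y" if "x \<in> space leb_I" "y \<in> space leb_I" for x y
      using P that by (simp add: prolate_system_def sums_def)
    show "\<bar>?S N x y\<bar> \<le> c / pi" if "x \<in> space leb_I" "y \<in> space leb_I" for N x y
      using prolate_partial_sum_bound[OF P] that by simp
  qed (use f g sigma_finite_lebesgue_Icc in measurable)
  \<comment> \<open>Each term of a finite partial sum is a product in \<open>x\<close> and
    \<open>y\<close>, so the double integral splits into two \<open>beta\<close>
    coefficients.\<close>
  moreover have "(LINT y|leb_I. (LINT x|leb_I. ?S N y x * phi i x) * phi j y)
      = (\<Sum>n<N. lam n * beta psi phi n i * beta psi phi n j)" for N
  proof -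
    have "(LINT x|leb_I. ?S N y x * phi i x) = (\<Sum>n<N. lam n * psi n y * beta psi phi n i)" for y
      using int[OF f] by (simp add: sum_distrib_right mult.assoc beta_def)
    then have "(LINT y|leb_I. (LINT x|leb_I. ?S N y x * phi i x) * phi j y)
        = (LINT y|leb_I. (\<Sum>n<N. (lam n * beta psi phi n i) * (psi n y * phi j y)))"
      by (simp only:) (simp add: sum_distrib_left mult_ac)
    also have "\<dots> = (\<Sum>n<N. lam n * beta psi phi n i * beta psi phi n j)"
      using int[OF g] by (simp add: beta_def)
    finally show ?thesis .
  qed
  moreover have "(LINT y|leb_I. (LINT x|leb_I. sinc_kernel c y x * phi i x) * phi j y)
      = c / pi * sinc_form c (phi i) (phi j)"
    unfolding sinc_form_def sinc_kernel_eq[OF \<open>c > 0\<close>] by (simp add: mult.assoc)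
  ultimately show ?thesis by (simp add: sums_def)
qed

theorem proposition3p1:
  fixes c :: real and phi :: "nat \<Rightarrow> real \<Rightarrow> real" and M :: nat
  assumes "c > 0"
    and "orthonormal_basis_on {-1..1} (\<lambda>n. cplx (phi n))"
  shows
    "(\<forall>k\<in>{1..M}. \<forall>j\<in>{1..M}.
        complex_of_real (T_mat c phi M $$ (k - 1, j - 1)) =
          of_real (pi / c) *
            inner_on {-1..1} (Q_op c (cplx (phi (k - 1)))) (cplx (phi (j - 1))) \<and>
        complex_of_real (T_mat c phi M $$ (k - 1, j - 1)) =
          1 / 2 *
            inner_on {-1..1} (F_op c (cplx (phi (k - 1)))) (F_op c (cplx (phi (j - 1))))) \<and>
     (\<forall>k\<in>{1..M}. \<forall>j\<in>{1..M}.
        complex_of_real (T_mat c phi M $$ (k - 1, j - 1)) =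
          of_real (pi / c) *
            inner_on UNIV (D_op (B_op c (D_op (zero_ext (cplx (phi (k - 1)))))))
              (zero_ext (cplx (phi (j - 1))))) \<and>
     (\<forall>x\<in>carrier_vec M. scalar_prod (T_mat c phi M *\<^sub>v x) x \<ge> 0) \<and>
     (\<forall>lam psi. prolate_system c lam psi \<longrightarrow>
        (\<forall>k\<in>{1..M}. \<forall>j\<in>{1..M}.
           summable (\<lambda>n. lam n * beta psi phi n (k - 1) * beta psi phi n (j - 1)) \<and>
           T_mat c phi M $$ (k - 1, j - 1) =
             pi / c * (\<Sum>n. lam n * beta psi phi n (k - 1) * beta psi phi n (j - 1))))"
proof (intro conjI ballI allI impI)
  have int: "integrable leb_I (phi n)" for n
    using assms(2) by (intro integrable_of_complete_on) (simp add: orthonormal_basis_on_def)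
  note int_cplx = integrable_cplx[OF int]
  \<comment> \<open>All goals about a pair of entries share this block; \<open>k\<close> and
    \<open>j\<close> start at 1, so \<open>k - 1\<close> and \<open>j - 1\<close> are genuine
    indices below \<open>M\<close>.\<close>
  {
    fix k j assume "k \<in> {1..M}" "j \<in> {1..M}"
    then have T: "T_mat c phi M $$ (k - 1, j - 1) = sinc_form c (phi (k - 1)) (phi (j - 1))"
      by (intro T_mat_eq_sinc_form) auto
    show Q: "complex_of_real (T_mat c phi M $$ (k - 1, j - 1)) =
        of_real (pi / c) * inner_on {-1..1} (Q_op c (cplx (phi (k - 1)))) (cplx (phi (j - 1)))"
      unfolding T inner_Q_op[OF assms(1)] using assms(1) by simp
    show "complex_of_real (T_mat c phi M $$ (k - 1, j - 1)) =
        1 / 2 * inner_on {-1..1} (F_op c (cplx (phi (k - 1)))) (F_op c (cplx (phi (j - 1))))"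
      unfolding T by (rule sinc_form_F_op[OF assms(1) int int])
    show "complex_of_real (T_mat c phi M $$ (k - 1, j - 1)) =
        of_real (pi / c) * inner_on UNIV (D_op (B_op c (D_op (zero_ext (cplx (phi (k - 1)))))))
              (zero_ext (cplx (phi (j - 1))))"
      unfolding inner_D_op_B_op_D_op[OF int_cplx int_cplx assms(1)] by (rule Q)
    fix lam psi assume P: "prolate_system c lam psi"
    note sums = sums_sinc_form[where phi = phi, OF assms(1) P int[of "k - 1"] int[of "j - 1"]]
    then show "summable (\<lambda>n. lam n * beta psi phi n (k - 1) * beta psi phi n (j - 1))"
      by (rule sums_summable)
    show "T_mat c phi M $$ (k - 1, j - 1) =
        pi / c * (\<Sum>n. lam n * beta psi phi n (k - 1) * beta psi phi n (j - 1))"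
      using assms(1) unfolding T sums_unique[OF sums, symmetric] by simp
  }
  fix x :: "real vec" assume x: "x \<in> carrier_vec M"
  have dim: "dim_row (T_mat c phi M) = M" "dim_col (T_mat c phi M) = M"
    by (simp_all add: T_mat_def)
  \<comment> \<open>Written out over 0-based indices, the scalar product is the quadratic form of
    \<open>sinc_form_nonneg\<close> with weights \<open>x $ i\<close>.\<close>
  have "(T_mat c phi M *\<^sub>v x) \<bullet> x
      = (\<Sum>i\<in>{0..<M}. \<Sum>j\<in>{0..<M}. sinc_form c (phi i) (phi j) * x $ i * x $ j)"
    using x dim by (simp add: scalar_prod_def sum_distrib_left T_mat_eq_sinc_form mult_ac)
  also have "\<dots> \<ge> 0"
    by (intro sinc_form_nonneg assms(1) int)
  finally show "0 \<le> (T_mat c phi M *\<^sub>v x) \<bullet> x" .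
qed

end
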